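(* Let $0<\delta<1$ with $1<\delta^2+\delta^6$, put $d_*=1/\sqrt{1-\delta^2}$, and let $q_{max}>0$, $s>0$ satisfy $$\frac{1}{\delta^4d_*^2}\Big(1+\frac{q_{max}}{\delta^2d_*^2}\Big)\le\delta^2-\frac{s}{\delta^2d_*^2}.$$ Let $X_*=\begin{pmatrix}1&0\\0&0\end{pmatrix}$, $X_\perp=\begin{pmatrix}0&0\\0&1\end{pmatrix}$ and let $\Phi:\mathbb{R}^{2\times2}\to\mathbb{R}^{2\times2}$ be given by $\Phi(Y)=X_*+\delta\|Y-X_*\|_F X_\perp$. Let $$\Omega=\{(p,q): 0\le p,\ 0\le q\le q_{max},\ q\le s\,p\},$$ and for a rank-one matrix $X\in\mathbb{R}^{2\times2}$ with $\sin^2\phi_R(X)>0$ let $$\pi(X)=\Big(\frac{\|X-X_*\|_F^2}{d_*^2}-1,\ \cot^2\phi_R(X)\Big).$$ Let $Y_0\in\pi^{-1}(\Omega)$, i.e. $Y_0$ is a rank-one $2\times 2$ real matrix with $\sin^2\phi_R(Y_0)>0$ and $\pi(Y_0)\in\Omega$, and let $Y_k=I(Y_{k-1},\Phi(Y_{k-1})-Y_{k-1})$ for $k\ge1$, where $I$ is the projector-splitting retraction (with rank $r=1$). Then the sequence $Y_k$ converges to $Y_*=d_*X_\perp$.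
   Context: For a rank-one $X\in\mathbb{R}^{2\times2}$, written as $X=\sigma\,u v^{\top}$ with unit vectors $u,v\in\mathbb{R}^2$, the right angle $\phi_R(X)$ is the angle with $v=(\cos\phi_R,\sin\phi_R)^{\top}$ (so $\sin^2\phi_R$, $\cot^2\phi_R$ are well defined). Projector-splitting retraction: given $A_0=U_0S_0V_0^{\top}$ with $U_0\in\mathbb{R}^{n\times r}$, $V_0\in\mathbb{R}^{m\times r}$ having orthonormal columns, $S_0\in\mathbb{R}^{r\times r}$, and $D\in\mathbb{R}^{n\times m}$, the matrix $I(A_0,D)=U_1S_1V_1^{\top}$ is computed by: (1) a QR factorization $U_0S_0+DV_0=U_1S'$ with $U_1\in\mathbb{R}^{n\times r}$, $U_1^{\top}U_1=I_r$; (2) $S''=S'-U_1^{\top}DV_0$; (3) a QR factorization $V_0S''^{\top}+D^{\top}U_1=V_1S_1^{\top}$ with $V_1\in\mathbb{R}^{m\times r}$, $V_1^{\top}V_1=I_r$. Here $n=m=2$, $r=1$.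
   Formalization: The limit is corrected from Y_*=d_* X_perp to Y_*=δ d_* X_perp: the printed limit is false (δ=12/13, q_max=s=1, Y_0=(12/5)X_perp gives a constant sequence, while d_*=13/5). *)

theory Defs
  imports "HOL-Analysis.Analysis"
begin

text \<open>
  The rank-\<open>r\<close> projector-splitting retraction, for \<open>r\<close> given by the index type \<open>'r\<close>. Neither the
  factors of \<open>A\<^sub>0\<close> nor a QR factorization is unique (\<open>R\<close> may even be singular, so no sign convention
  is imposed on its diagonal), hence the retraction is the relation ``\<open>A\<^sub>1\<close> is a possible result of
  the procedure''.
\<close>

definition orthonormal_columns :: "real^'r^'n \<Rightarrow> bool" where
  "orthonormal_columns U \<longleftrightarrow> transpose U ** U = mat 1"

definition qr_factorization ::
    "real^('r::{finite,linorder})^'n \<Rightarrow> real^('r::{finite,linorder})^'n \<Rightarrow>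
     real^('r::{finite,linorder})^('r::{finite,linorder}) \<Rightarrow> bool" where
  "qr_factorization M Q R \<longleftrightarrow>
     M = Q ** R \<and> orthonormal_columns Q \<and> (\<forall>i j. j < i \<longrightarrow> R $ i $ j = 0)"

definition projector_splitting ::
    "'r::{finite,linorder} itself \<Rightarrow> real^'m^'n \<Rightarrow> real^'m^'n \<Rightarrow> real^'m^'n \<Rightarrow> bool" where
  "projector_splitting (r :: 'r::{finite,linorder} itself) A\<^sub>0 D A\<^sub>1 \<longleftrightarrow>
     (\<exists>(U\<^sub>0 :: real^('r::{finite,linorder})^'n) (S\<^sub>0 :: real^('r::{finite,linorder})^('r::{finite,linorder}))
       (V\<^sub>0 :: real^('r::{finite,linorder})^'m) U\<^sub>1 S' S'' V\<^sub>1 S\<^sub>1.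
        orthonormal_columns U\<^sub>0 \<and> orthonormal_columns V\<^sub>0 \<and>
        A\<^sub>0 = U\<^sub>0 ** S\<^sub>0 ** transpose V\<^sub>0 \<and>
        qr_factorization (U\<^sub>0 ** S\<^sub>0 + D ** V\<^sub>0) U\<^sub>1 S' \<and>
        S'' = S' - transpose U\<^sub>1 ** D ** V\<^sub>0 \<and>
        qr_factorization (V\<^sub>0 ** transpose S'' + transpose D ** U\<^sub>1) V\<^sub>1 (transpose S\<^sub>1) \<and>
        A\<^sub>1 = U\<^sub>1 ** S\<^sub>1 ** transpose V\<^sub>1)"

text \<open>
  The right angle of a rank-one matrix is determined only modulo \<open>\<pi>\<close>, because \<open>(\<sigma>, v)\<close> may be replaced
  by \<open>(- \<sigma>, - v)\<close>; \<open>right_angle\<close> picks a representative.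
\<close>

definition is_right_angle :: "real^2^2 \<Rightarrow> real \<Rightarrow> bool" where
  "is_right_angle X \<phi> \<longleftrightarrow>
     (\<exists>\<sigma> (u :: real^2) (v :: real^2). norm u = 1 \<and> norm v = 1 \<and>
        X = \<sigma> *\<^sub>R ((columnvector u :: real^1^2) ** (rowvector v :: real^2^1)) \<and>
        v = vector [cos \<phi>, sin \<phi>])"

definition right_angle :: "real^2^2 \<Rightarrow> real" where
  "right_angle X = (SOME \<phi>. is_right_angle X \<phi>)"

definition X_star :: "real^2^2" where
  "X_star = vector [vector [1, 0], vector [0, 0]]"

definition X_perp :: "real^2^2" where
  "X_perp = vector [vector [0, 0], vector [0, 1]]"

definition d_star :: "real \<Rightarrow> real" where
  "d_star \<delta> = 1 / sqrt (1 - \<delta>^2)"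

text \<open>On \<open>real^2^2\<close> the library's \<open>norm\<close> is the Frobenius norm.\<close>

definition \<Phi> :: "real \<Rightarrow> real^2^2 \<Rightarrow> real^2^2" where
  "\<Phi> \<delta> Y = X_star + (\<delta> * norm (Y - X_star)) *\<^sub>R X_perp"

definition \<Omega> :: "real \<Rightarrow> real \<Rightarrow> (real \<times> real) set" where
  "\<Omega> qmax s = {(p, q). 0 \<le> p \<and> 0 \<le> q \<and> q \<le> qmax \<and> q \<le> s * p}"

definition chart :: "real \<Rightarrow> real^2^2 \<Rightarrow> real \<times> real" where
  "chart \<delta> X = ((norm (X - X_star))^2 / (d_star \<delta>)^2 - 1, (cot (right_angle X))^2)"

text \<open>
  The source prints the limit as \<open>d\<^sub>* X\<^sub>\<bottom>\<close>, omitting the factor \<open>\<delta>\<close>; with that reading the convergence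
  claim is false. The rank-one solution of \<open>Y = \<delta> \<parallel>Y - X\<^sub>*\<parallel> X\<^sub>\<bottom>\<close> is \<open>Y = y X\<^sub>\<bottom>\<close> with
  \<open>y\<^sup>2 = \<delta>\<^sup>2 (1 + y\<^sup>2)\<close>, i.e. \<open>y = \<delta> d\<^sub>*\<close>. It is stationary under the iteration, \<open>d\<^sub>*\<close> is its distance to
  \<open>X\<^sub>*\<close>, and \<open>chart\<close> maps it to \<open>(0, 0)\<close>.
\<close>

definition Y_star :: "real \<Rightarrow> real^2^2" where
  "Y_star \<delta> = (\<delta> * d_star \<delta>) *\<^sub>R X_perp"

end

theory Submission
  imports Defs
begin

text \<open>
  Write \<open>Z = A\<^sub>0 + D\<close>. The three substeps of the projector-splitting retraction telescope: the
  result is \<open>U U\<^sup>T Z\<close>, the orthogonal projection of \<open>Z\<close> onto a space that contains the range of \<open>Z V\<close>,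
  where the columns of \<open>V\<close> span a space containing the row space of \<open>A\<^sub>0\<close> (lemma
  \<open>projector_splitting_eq_projection\<close>). When \<open>r = 1\<close>, \<open>A\<^sub>0 \<noteq> 0\<close> and \<open>Z\<close> is invertible, that space is the line
  through the nonzero column \<open>Z V\<close>, so the result is independent of the factorizations chosen.

  In the iteration \<open>Z = \<Phi> \<delta> Y = diag(1, t)\<close> with \<open>t = \<delta> \<parallel>Y - X\<^sub>*\<parallel> > 0\<close>, and a rank-one \<open>Y\<close> enters only
  through \<open>t\<close> and through the slope \<open>x = cot \<phi>\<^sub>R(Y)\<close> of its row space. Hence the new iterate is an
  explicit matrix \<open>splitting_image t x\<close>, whose row slope is \<open>x / t\<^sup>2\<close> and whose squared distance to
  \<open>X\<^sub>*\<close> is \<open>t\<^sup>2 (1 + t\<^sup>2) / (x\<^sup>2 + t\<^sup>2)\<close>. In the chart coordinates \<open>(p, q)\<close>, with \<open>b = d\<^sub>*\<^sup>2\<close> and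
  \<open>T = t\<^sup>2 = \<delta>\<^sup>2 b (1 + p)\<close>, and because \<open>b = 1 + \<delta>\<^sup>2 b\<close>, one step reads
  \<open>p' = \<delta>\<^sup>2 p - (1 + \<delta>\<^sup>2 p) q / (q + T)\<close> and \<open>q' = q / T\<^sup>2\<close>.

  Thus \<open>p' \<le> \<delta>\<^sup>2 p\<close>. On the other side the subtracted term is at most \<open>q / (\<delta>\<^sup>2 b) \<le> s p / (\<delta>\<^sup>2 b)\<close>,
  so \<open>p' \<ge> (\<delta>\<^sup>2 - s / (\<delta>\<^sup>2 b)) p\<close>. The inequality relating \<open>qmax\<close> and \<open>s\<close> makes this factor at least
  \<open>1 / (\<delta>\<^sup>4 b) \<ge> 1 / (\<delta>\<^sup>2 b)\<^sup>2\<close>, while \<open>q' \<le> q / (\<delta>\<^sup>2 b)\<^sup>2\<close>; hence \<open>q' \<le> s p'\<close>. The condition \<open>1 < \<delta>\<^sup>2 + \<delta>\<^sup>6\<close> means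
  \<open>\<delta>\<^sup>6 b > 1\<close>, whence \<open>T > 1\<close> and \<open>q\<close> does not grow. So \<open>\<Omega>\<close> is invariant, \<open>p\<close> decays
  geometrically, \<open>q \<le> s p\<close> is dragged along, and the explicit formula gives the limit of the matrices.
\<close>

section \<open>The retraction as a projection\<close>

lemma matrix_add_rdistrib:
  fixes A B :: "real^'m^'n" and C :: "real^'k^'m"
  shows "(A + B) ** C = A ** C + B ** C"
  by (vector matrix_matrix_mult_def sum.distrib[symmetric] field_simps)

text \<open>
  Since \<open>S'\<close> is \<open>U\<^sup>T Z V\<close> with \<open>Z = A\<^sub>0 + D\<close>, subtracting \<open>U\<^sup>T D V\<close> leaves \<open>U\<^sup>T A\<^sub>0 V\<close>. As \<open>V V\<^sup>T\<close> fixes the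
  row space of \<open>A\<^sub>0\<close>, the matrix factorized in the last substep is \<open>Z\<^sup>T U\<close>.
\<close>

lemma projector_splitting_eq_projection:
  fixes A\<^sub>0 D A\<^sub>1 :: "real^'m^'n"
  assumes "projector_splitting TYPE('r::{finite,linorder}) A\<^sub>0 D A\<^sub>1"
  obtains U :: "real^('r::{finite,linorder})^'n" and V :: "real^('r::{finite,linorder})^'m" and R
  where "orthonormal_columns U" "A\<^sub>0 ** V ** transpose V = A\<^sub>0"
    "(A\<^sub>0 + D) ** V = U ** R" "A\<^sub>1 = U ** transpose U ** (A\<^sub>0 + D)"
proof -
  from assms obtain U\<^sub>0 :: "((real, 'r) vec, 'n) vec" and S\<^sub>0 :: "((real, 'r) vec, 'r) vec"
    and V\<^sub>0 :: "((real, 'r) vec, 'm) vec" and U :: "((real, 'r) vec, 'n) vec"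
    and R :: "((real, 'r) vec, 'r) vec" and S''
    and V\<^sub>1 :: "((real, 'r) vec, 'm) vec" and S\<^sub>1
    where V0: "transpose V\<^sub>0 ** V\<^sub>0 = mat 1"
      and A0: "A\<^sub>0 = U\<^sub>0 ** S\<^sub>0 ** transpose V\<^sub>0"
      and KR: "U\<^sub>0 ** S\<^sub>0 + D ** V\<^sub>0 = U ** R"
      and U: "orthonormal_columns U"
      and S'': "S'' = R - transpose U ** D ** V\<^sub>0"
      and L: "V\<^sub>0 ** transpose S'' + transpose D ** U = V\<^sub>1 ** transpose S\<^sub>1"
      and A1: "A\<^sub>1 = U ** S\<^sub>1 ** transpose V\<^sub>1"
    unfolding projector_splitting_def qr_factorization_def orthonormal_columns_def by blast
  have AV: "A\<^sub>0 ** V\<^sub>0 = U\<^sub>0 ** S\<^sub>0"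
    using V0 by (simp add: A0 matrix_mul_assoc[symmetric])
  then have AVV: "A\<^sub>0 ** V\<^sub>0 ** transpose V\<^sub>0 = A\<^sub>0"
    by (simp add: A0)
  have ZV: "(A\<^sub>0 + D) ** V\<^sub>0 = U ** R"
    using KR AV by (simp add: matrix_add_rdistrib)
  have "transpose U ** (U ** R) = R"
    using U by (simp add: orthonormal_columns_def matrix_mul_assoc)
  then have "R = transpose U ** (A\<^sub>0 ** V\<^sub>0) + transpose U ** (D ** V\<^sub>0)"
    using ZV by (metis matrix_add_ldistrib matrix_add_rdistrib)
  then have "S'' = transpose U ** A\<^sub>0 ** V\<^sub>0"
    by (simp add: S'' matrix_mul_assoc)
  then have "V\<^sub>0 ** transpose S'' = transpose (transpose U ** (A\<^sub>0 ** V\<^sub>0 ** transpose V\<^sub>0))"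
    by (simp add: matrix_transpose_mul matrix_mul_assoc)
  then have "V\<^sub>0 ** transpose S'' = transpose A\<^sub>0 ** U"
    by (simp only: AVV) (simp add: matrix_transpose_mul)
  then have "V\<^sub>1 ** transpose S\<^sub>1 = (transpose A\<^sub>0 + transpose D) ** U"
    using L by (simp add: matrix_add_rdistrib)
  also have "transpose A\<^sub>0 + transpose D = transpose (A\<^sub>0 + D)"
    by (simp add: transpose_def vec_eq_iff)
  finally have "transpose (V\<^sub>1 ** transpose S\<^sub>1) = transpose U ** (A\<^sub>0 + D)"
    by (simp add: matrix_transpose_mul)
  then have "S\<^sub>1 ** transpose V\<^sub>1 = transpose U ** (A\<^sub>0 + D)"
    by (simp add: matrix_transpose_mul)
  then have "A\<^sub>1 = U ** transpose U ** (A\<^sub>0 + D)"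
    by (simp only: A1 flip: matrix_mul_assoc)
  with U AVV ZV that show thesis by blast
qed

section \<open>One step of the iteration\<close>

text \<open>
  A nonzero \<open>Y\<close> with \<open>has_row_slope Y x\<close> is a rank-one matrix whose rows are multiples of \<open>(x, 1)\<close>,
  so that \<open>x\<close> is the cotangent of its right angle.
\<close>

definition has_row_slope :: "real^2^2 \<Rightarrow> real \<Rightarrow> bool" where
  "has_row_slope Y x \<longleftrightarrow> Y \<noteq> 0 \<and> (\<forall>i. Y $ i $ 1 = x * Y $ i $ 2)"

text \<open>The orthogonal projection of \<open>diag(1, t)\<close> onto the line spanned by \<open>diag(1, t) (x, 1)\<^sup>T\<close>.\<close>

definition splitting_image :: "real \<Rightarrow> real \<Rightarrow> real^2^2" where
  "splitting_image t x =
     (1 / (x^2 + t^2)) *\<^sub>R vector [vector [x^2, x * t^2], vector [x * t, t^3]]"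

lemmas two_by_two = vec_eq_iff forall_2 sum_2 vector_2 matrix_matrix_mult_def transpose_def

lemma \<Phi>_entries:
  "\<Phi> \<delta> Y $ 1 $ 1 = 1" "\<Phi> \<delta> Y $ 1 $ 2 = 0" "\<Phi> \<delta> Y $ 2 $ 1 = 0"
  "\<Phi> \<delta> Y $ 2 $ 2 = \<delta> * norm (Y - X_star)"
  by (simp_all add: \<Phi>_def X_star_def X_perp_def)

text \<open>
  The factors \<open>U\<close> and \<open>V\<close> are single columns \<open>(u1, u2)\<^sup>T\<close>, of length 1, and \<open>(v1, v2)\<^sup>T\<close>. The row slope of \<open>Y\<close> forces
  \<open>v1 = x v2\<close>, and \<open>diag(1, t) (v1, v2)\<^sup>T\<close> being a multiple of \<open>(u1, u2)\<^sup>T\<close> then forces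
  \<open>t u1 = x u2\<close>. This determines \<open>(u1, u2)\<^sup>T\<close> up to sign, hence the projection onto it.
\<close>

lemma projector_splitting_\<Phi>:
  fixes \<delta> x :: real and Y Y' :: "real^2^2"
  defines "t \<equiv> \<delta> * norm (Y - X_star)"
  assumes slope: "has_row_slope Y x" and t: "t \<noteq> 0"
    and step: "projector_splitting TYPE(1) Y (\<Phi> \<delta> Y - Y) Y'"
  shows "Y' = splitting_image t x"
proof -
  from step obtain U V :: "real^1^2" and R :: "real^1^1"
    where U: "orthonormal_columns U" and YV: "Y ** V ** transpose V = Y"
      and ZV: "\<Phi> \<delta> Y ** V = U ** R" and Y': "Y' = U ** transpose U ** \<Phi> \<delta> Y"
    by (rule projector_splitting_eq_projection) simp
  define v1 v2 u1 u2 r where "v1 = V $ 1 $ 1" and "v2 = V $ 2 $ 1" and "u1 = U $ 1 $ 1"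
    and "u2 = U $ 2 $ 1" and "r = R $ 1 $ 1"
  note vars = v1_def v2_def u1_def u2_def r_def
  have u: "u1^2 + u2^2 = 1"
    using U by (simp add: orthonormal_columns_def two_by_two mat_def vars power2_eq_square)
  have zv: "v1 = u1 * r" "t * v2 = u2 * r"
    using ZV by (simp_all add: two_by_two \<Phi>_entries vars t_def)
  have Y1: "Y $ i $ 1 = x * Y $ i $ 2" for i
    using slope by (simp add: has_row_slope_def)
  \<comment> \<open>A zero second column would make the first one zero as well.\<close>
  obtain i where i: "Y $ i $ 2 \<noteq> 0"
    using slope by (auto simp: has_row_slope_def vec_eq_iff forall_2)
  have row: "Y $ i $ j = (Y $ i $ 1 * v1 + Y $ i $ 2 * v2) * V $ j $ 1" for j
  proof -
    have "Y $ i $ j = (Y ** V ** transpose V) $ i $ j"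
      by (simp only: YV)
    also have "\<dots> = (Y $ i $ 1 * v1 + Y $ i $ 2 * v2) * V $ j $ 1"
      by (simp add: matrix_matrix_mult_def transpose_def sum_2 vars)
    finally show ?thesis .
  qed
  have "Y $ i $ 2 * ((x * v1 + v2) * v1) = Y $ i $ 2 * x"
    using row[of 1, folded v1_def, unfolded Y1] by algebra
  moreover have "Y $ i $ 2 * ((x * v1 + v2) * v2) = Y $ i $ 2 * 1"
    using row[of 2, folded v2_def, unfolded Y1] by algebra
  ultimately have v: "(x * v1 + v2) * v1 = x" "(x * v1 + v2) * v2 = 1"
    unfolding mult_left_cancel[OF i] by blast+
  then have "v1 = x * v2"
    by (metis mult.assoc mult.commute mult_1_right)
  have "r \<noteq> 0"
    using v zv t by auto
  have "r * (t * u1) = r * (x * u2)"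
    using zv \<open>v1 = x * v2\<close> by algebra
  with \<open>r \<noteq> 0\<close> have tu: "t * u1 = x * u2"
    by simp
  have nz: "x^2 + t^2 \<noteq> 0"
    using t by (simp add: sum_power2_eq_zero_iff)
  have prods: "u2 * u2 * (x^2 + t^2) = t^2" "u1 * u2 * (x^2 + t^2) = x * t"
    "u1 * u1 * (x^2 + t^2) = x^2"
  proof -
    show eq: "u2 * u2 * (x^2 + t^2) = t^2"
      using u tu by algebra
    have "t * (u1 * u2 * (x^2 + t^2)) = t * (x * t)"
      using eq tu by algebra
    with t show "u1 * u2 * (x^2 + t^2) = x * t"
      by simp
    show "u1 * u1 * (x^2 + t^2) = x^2"
      using u eq by algebra
  qed
  have "u2 * u2 = t^2 / (x^2 + t^2)" "u1 * u2 = x * t / (x^2 + t^2)" "u1 * u1 = x^2 / (x^2 + t^2)"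
    using nz t prods by (auto simp: eq_divide_eq)
  then have "Y' $ 1 $ 1 = x^2 / (x^2 + t^2)" "Y' $ 1 $ 2 = x * t / (x^2 + t^2) * t"
    "Y' $ 2 $ 1 = x * t / (x^2 + t^2)" "Y' $ 2 $ 2 = t^2 / (x^2 + t^2) * t"
    by (simp_all add: Y' matrix_matrix_mult_def transpose_def sum_2 \<Phi>_entries vars t_def mult.commute)
  then show ?thesis
    by (simp add: splitting_image_def vec_eq_iff forall_2 power2_eq_square power3_eq_cube)
qed

lemma has_row_slope_splitting_image:
  assumes "t \<noteq> 0"
  shows "has_row_slope (splitting_image t x) (x / t^2)"
proof -
  have "x^2 + t^2 \<noteq> 0"
    using assms by (simp add: sum_power2_eq_zero_iff)
  then have "splitting_image t x $ 2 $ 2 \<noteq> 0"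
    using assms by (simp add: splitting_image_def)
  then have "splitting_image t x \<noteq> 0"
    by auto
  then show ?thesis
    using assms
    by (simp add: has_row_slope_def splitting_image_def forall_2 power2_eq_square power3_eq_cube)
qed

lemma norm_splitting_image:
  assumes "t \<noteq> 0"
  shows "(norm (splitting_image t x - X_star))^2 = t^2 * (1 + t^2) / (x^2 + t^2)"
proof -
  define n where "n = x^2 + t^2"
  have n: "n \<noteq> 0"
    using assms by (simp add: n_def sum_power2_eq_zero_iff)
  have "(norm (splitting_image t x - X_star))^2
      = (x^2 / n - 1)^2 + (x * t^2 / n)^2 + ((x * t / n)^2 + (t^3 / n)^2)"
    by (simp add: norm_vec_def L2_set_def sum_2 splitting_image_def X_star_def n_def)
  also have "x^2 / n - 1 = - (t^2) / n"
    using n by (simp add: n_def field_simps)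
  also have "(- (t^2) / n)^2 + (x * t^2 / n)^2 + ((x * t / n)^2 + (t^3 / n)^2)
      = (t^4 + x^2 * t^4 + x^2 * t^2 + t^6) / n^2"
    by (simp add: power_divide add_divide_distrib power_mult_distrib flip: power_mult)
  also have "t^4 + x^2 * t^4 + x^2 * t^2 + t^6 = t^2 * (1 + t^2) * n"
    unfolding n_def by algebra
  also have "\<dots> / n^2 = t^2 * (1 + t^2) / n"
    using n by (simp add: power2_eq_square)
  finally show ?thesis
    by (simp add: n_def)
qed

section \<open>Dynamics in the chart\<close>

text \<open>
  With \<open>b = d\<^sub>*\<^sup>2\<close> and \<open>T = t\<^sup>2\<close>, the next iterate has chart coordinates \<open>(p', q / T\<^sup>2)\<close>, so this is
  invariance of \<open>\<Omega>\<close> together with contraction of \<open>p\<close>. Everything rests on comparing \<open>T\<close> with its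
  value \<open>a = \<delta>\<^sup>2 b\<close> at \<open>p = 0\<close>, which exceeds 1, and on the identity \<open>b = 1 + a\<close>, which turns the
  formula for \<open>p'\<close> into \<open>\<delta>\<^sup>2 p\<close> minus a small term.
\<close>

lemma chart_step:
  fixes \<delta> b p q qmax s T p' :: real
  assumes \<delta>: "0 < \<delta>" "\<delta> < 1" "1 < \<delta>^2 + \<delta>^6" and b: "b * (1 - \<delta>^2) = 1"
    and qmax: "0 < qmax" and s: "0 < s"
    and bound: "1 / (\<delta>^4 * b) * (1 + qmax / (\<delta>^2 * b)) \<le> \<delta>^2 - s / (\<delta>^2 * b)"
    and p: "0 \<le> p" and q: "0 \<le> q" "q \<le> qmax" "q \<le> s * p"
    and T_eq: "T = \<delta>^2 * (b * (1 + p))" and p'_eq: "p' = T * (1 + T) / (q + T) / b - 1"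
  shows "0 \<le> p'" "p' \<le> \<delta>^2 * p" "q / T^2 \<le> qmax" "q / T^2 \<le> s * p'"
proof -
  define a where "a = \<delta>^2 * b"
  have \<delta>2: "0 < \<delta>^2" "\<delta>^2 < 1"
    using \<delta> by (simp_all add: power_less_one_iff)
  have b1: "b = 1 + a"
    using b by (simp add: a_def algebra_simps)
  have "b > 0"
    using b \<delta>2 by (smt (verit) mult_nonpos_nonneg)
  then have "a > 0"
    using \<delta>2 by (simp add: a_def)
  \<comment> \<open>The hypothesis is \<open>\<delta>\<^sup>6 b > 1\<close>, and \<open>\<delta>\<^sup>6 b = a \<delta>\<^sup>4 \<le> a\<close>.\<close>
  have "b * (1 - \<delta>^2) < b * \<delta>^6"
    using \<delta> \<open>b > 0\<close> by simp
  moreover have "b * \<delta>^6 = a * \<delta>^4"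
    by (simp add: a_def flip: power_add)
  moreover have "a * \<delta>^4 \<le> a * 1"
    using \<open>a > 0\<close> \<delta> by (intro mult_left_mono power_le_one) auto
  ultimately have "a > 1"
    using b by simp
  have T: "T = a * (1 + p)"
    by (simp add: T_eq a_def)
  have aT: "a \<le> T"
    using p \<open>a > 0\<close> by (simp add: T)
  have "q / T^2 \<le> q / a^2"
    using aT \<open>a > 0\<close> q by (intro divide_left_mono power_mono) auto
  moreover have "q / a^2 \<le> q / 1"
    using q \<open>a > 1\<close> by (intro divide_left_mono) (auto simp: one_le_power)
  ultimately show "q / T^2 \<le> qmax"
    using q by simp

  have b1T: "1 + T = b * (1 + \<delta>^2 * p)"
    using b1 by (simp add: T a_def algebra_simps)
  have qT: "q + T > 0"
    using q aT \<open>a > 0\<close> by linarith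
  have p': "p' = \<delta>^2 * p - (1 + \<delta>^2 * p) * q / (q + T)"
  proof -
    have "T * (b * (1 + \<delta>^2 * p)) / (q + T) / b = (1 + \<delta>^2 * p) * (T / (q + T))"
      using \<open>b > 0\<close> by simp
    also have "T / (q + T) = 1 - q / (q + T)"
      using qT by (simp add: field_simps)
    finally show ?thesis
      by (simp add: p'_eq b1T right_diff_distrib)
  qed
  have "0 \<le> (1 + \<delta>^2 * p) * q / (q + T)"
    using q p qT by simp
  then show "p' \<le> \<delta>^2 * p"
    by (simp add: p')
  have "(1 + \<delta>^2 * p) * q / (q + T) \<le> (1 + p) * q / T"
  proof (rule frac_le)
    show "(1 + \<delta>^2 * p) * q \<le> (1 + p) * q"
      using p q \<delta>2 by (intro mult_right_mono add_left_mono) (auto simp: mult_left_le_one_le)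
  qed (use p q aT \<open>a > 0\<close> in auto)
  also have "(1 + p) * q / T = q / a"
    using p \<open>a > 0\<close> by (simp add: T)
  also have "q / a \<le> s * p / a"
    using q \<open>a > 0\<close> by (simp add: divide_right_mono)
  finally have "(\<delta>^2 - s / a) * p \<le> p'"
    by (simp add: p' algebra_simps)
  moreover have "1 / (\<delta>^4 * b) \<le> \<delta>^2 - s / a"
  proof -
    have "1 / (\<delta>^4 * b) * 1 \<le> 1 / (\<delta>^4 * b) * (1 + qmax / a)"
      using \<open>b > 0\<close> \<open>a > 0\<close> qmax \<delta> by (intro mult_left_mono) auto
    with bound show ?thesis
      by (simp add: a_def)
  qed
  ultimately have lower: "1 / (\<delta>^4 * b) * p \<le> p'"
    using p by (meson mult_right_mono order_trans)
  moreover have "0 \<le> 1 / (\<delta>^4 * b) * p"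
    using p \<open>b > 0\<close> by simp
  ultimately show "0 \<le> p'"
    by linarith
  \<comment> \<open>Here \<open>b \<ge> 1\<close> enters: the factor \<open>1 / (\<delta>\<^sup>4 b)\<close> dominates the decay factor \<open>1 / a\<^sup>2\<close> of \<open>q\<close>.\<close>
  have "1 / a^2 = 1 / (\<delta>^4 * b) / b"
    by (simp add: a_def power2_eq_square power_def numeral_eq_Suc)
  also have "\<dots> \<le> 1 / (\<delta>^4 * b) / 1"
    using b1 \<open>a > 0\<close> \<open>b > 0\<close> by (intro divide_left_mono) auto
  finally have "s * p * (1 / a^2) \<le> s * p * (1 / (\<delta>^4 * b))"
    using s p by (intro mult_left_mono) auto
  moreover have "s * (1 / (\<delta>^4 * b) * p) \<le> s * p'"
    using lower s by (intro mult_left_mono) auto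
  moreover have "q / a^2 \<le> s * p / a^2"
    using q by (simp add: divide_right_mono)
  ultimately show "q / T^2 \<le> s * p'"
    using \<open>q / T^2 \<le> q / a^2\<close> by (simp add: mult.commute mult.left_commute)
qed

section \<open>The right angle of a rank-one matrix\<close>

lemma rank_one_imp_scaled_outer_product:
  fixes X :: "real^'m^'n"
  assumes "rank X = 1"
  obtains \<sigma> u v where "norm u = 1" "norm v = 1"
    "X = \<sigma> *\<^sub>R ((columnvector u :: real^1^'n) ** (rowvector v :: real^'m^1))"
proof -
  have "X \<noteq> 0"
    using assms by auto
  have "dim (rows X) = 1"
    using assms by (simp add: row_rank_def)
  then obtain B where B: "rows X \<subseteq> span B" "card B = 1"
    by (metis basis_exists)
  then obtain w where "B = {w}"
    by (auto simp: card_1_singleton_iff)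
  have "\<exists>c. X $ i = c *\<^sub>R w" for i
  proof -
    have "X $ i \<in> rows X"
      by (auto simp: rows_def row_def vec_eq_iff)
    then show ?thesis
      using B \<open>B = {w}\<close> by (auto simp: span_singleton)
  qed
  then obtain c where c: "X $ i = c i *\<^sub>R w" for i
    by metis
  define z :: "real^'n" where "z = (\<chi> i. c i)"
  have "w \<noteq> 0" "z \<noteq> 0"
    using \<open>X \<noteq> 0\<close> c by (auto simp: vec_eq_iff z_def)
  show thesis
  proof (rule that)
    show "norm (z /\<^sub>R norm z) = 1" "norm (w /\<^sub>R norm w) = 1"
      using \<open>w \<noteq> 0\<close> \<open>z \<noteq> 0\<close> by simp_all
    show "X = (norm z * norm w) *\<^sub>R ((columnvector (z /\<^sub>R norm z) :: real^1^'n)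
        ** (rowvector (w /\<^sub>R norm w) :: real^'m^1))"
    proof -
      have "X $ i $ j = z $ i * w $ j" for i j
        by (simp add: c z_def)
      moreover have "norm z \<noteq> 0" "norm w \<noteq> 0"
        using \<open>w \<noteq> 0\<close> \<open>z \<noteq> 0\<close> by simp_all
      ultimately show ?thesis
        by (simp add: vec_eq_iff matrix_matrix_mult_def columnvector_def rowvector_def field_simps)
    qed
  qed
qed

text \<open>\<open>right_angle\<close> is a Hilbert choice, so facts about it need the existence of some right angle.\<close>

lemma is_right_angle_right_angle:
  assumes "rank X = 1"
  shows "is_right_angle X (right_angle X)"
proof -
  obtain \<sigma> and u v :: "real^2" where X: "norm u = 1" "norm v = 1"
    "X = \<sigma> *\<^sub>R ((columnvector u :: real^1^2) ** (rowvector v :: real^2^1))"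
    using rank_one_imp_scaled_outer_product[OF assms] .
  have "(v $ 1)^2 + (v $ 2)^2 = 1"
    using \<open>norm v = 1\<close> by (simp add: norm_vec_def L2_set_def sum_2)
  then obtain \<phi> where "v $ 1 = cos \<phi>" "v $ 2 = sin \<phi>"
    by (metis sincos_total_2pi)
  then have "v = vector [cos \<phi>, sin \<phi>]"
    by (simp add: vec_eq_iff forall_2)
  with X have "is_right_angle X \<phi>"
    unfolding is_right_angle_def by blast
  then show ?thesis
    unfolding right_angle_def by (rule someI)
qed

lemma has_row_slope_cot_right_angle:
  assumes "rank X = 1" "sin (right_angle X) \<noteq> 0"
  shows "has_row_slope X (cot (right_angle X))"
proof -
  have "X \<noteq> 0"
    using assms(1) by auto
  moreover obtain \<sigma> and u v :: "real^2"
    where "X = \<sigma> *\<^sub>R ((columnvector u :: real^1^2) ** (rowvector v :: real^2^1))"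
      and "v = vector [cos (right_angle X), sin (right_angle X)]"
    using is_right_angle_right_angle[OF assms(1)] unfolding is_right_angle_def by blast
  then have "X $ i $ 1 = \<sigma> * u $ i * cos (right_angle X)"
    and "X $ i $ 2 = \<sigma> * u $ i * sin (right_angle X)" for i
    by (simp_all add: vec_eq_iff matrix_matrix_mult_def columnvector_def rowvector_def)
  ultimately show ?thesis
    using assms(2) by (simp add: has_row_slope_def cot_def)
qed

section \<open>Convergence\<close>

theorem theorem6p3:
  fixes \<delta> qmax s :: real and Y :: "nat \<Rightarrow> real^2^2"
  assumes "0 < \<delta>" "\<delta> < 1" "1 < \<delta>^2 + \<delta>^6"
    and "qmax > 0" "s > 0"
    and "1 / (\<delta>^4 * (d_star \<delta>)^2) * (1 + qmax / (\<delta>^2 * (d_star \<delta>)^2))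
           \<le> \<delta>^2 - s / (\<delta>^2 * (d_star \<delta>)^2)"
    and "rank (Y 0) = 1" "(sin (right_angle (Y 0)))^2 > 0" "chart \<delta> (Y 0) \<in> \<Omega> qmax s"
    and "\<forall>k\<ge>1. projector_splitting TYPE(1) (Y (k - 1)) (\<Phi> \<delta> (Y (k - 1)) - Y (k - 1)) (Y k)"
  shows "Y \<longlonglongrightarrow> Y_star \<delta>"
proof -
  define b where "b = (d_star \<delta>)^2"
  define p where "p k = (norm (Y k - X_star))^2 / b - 1" for k
  define t where "t k = \<delta> * norm (Y k - X_star)" for k
  have "\<delta>^2 < 1"
    using assms(1,2) by (simp add: power_less_one_iff)
  then have b: "b * (1 - \<delta>^2) = 1" and "b > 0" and "d_star \<delta> > 0"
    by (simp_all add: b_def d_star_def power_divide)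
  have step: "projector_splitting TYPE(1) (Y k) (\<Phi> \<delta> (Y k) - Y k) (Y (Suc k))" for k
    using assms(10)[rule_format, of "Suc k"] by simp
  have norm_sq: "(norm (Y k - X_star))^2 = b * (1 + p k)" for k
    using \<open>b > 0\<close> by (simp add: p_def)
  then have t_sq: "(t k)^2 = \<delta>^2 * (b * (1 + p k))" for k
    by (simp add: t_def power_mult_distrib)
  have t_pos: "t k > 0" if "0 \<le> p k" for k
  proof -
    have "norm (Y k - X_star) \<noteq> 0"
      using norm_sq[of k] that \<open>b > 0\<close> by auto
    then show ?thesis
      using assms(1) by (simp add: t_def)
  qed
  have image: "Y (Suc k) = splitting_image (t k) x" if "has_row_slope (Y k) x" "0 \<le> p k" for k x
    using projector_splitting_\<Phi>[OF that(1) _ step] t_pos[OF that(2)]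
    unfolding t_def by (metis less_irrefl)
  have p_Suc: "p (Suc k) = (t k)^2 * (1 + (t k)^2) / (x^2 + (t k)^2) / b - 1"
    if "has_row_slope (Y k) x" "0 \<le> p k" for k x
    using norm_splitting_image[of "t k" x] image[OF that] t_pos[OF that(2)]
    by (simp add: p_def)
  note invariant_step =
    chart_step[OF assms(1-3) b assms(4,5) assms(6)[folded b_def] _ zero_le_power2 _ _ t_sq]

  \<comment> \<open>The iterates stay in \<open>\<Omega>\<close>; the slope \<open>x\<close> replaces the chosen right angle, with \<open>q = x\<^sup>2\<close>.\<close>
  have "\<exists>x. has_row_slope (Y k) x \<and> 0 \<le> p k \<and> x^2 \<le> qmax \<and> x^2 \<le> s * p k" for k
  proof (induction k)
    case 0
    have "has_row_slope (Y 0) (cot (right_angle (Y 0)))"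
      using has_row_slope_cot_right_angle assms(7,8) by simp
    then show ?case
      using assms(9) by (auto simp: chart_def \<Omega>_def p_def b_def)
  next
    case (Suc k)
    then obtain x where x: "has_row_slope (Y k) x" "0 \<le> p k" "x^2 \<le> qmax" "x^2 \<le> s * p k"
      by blast
    have "t k \<noteq> 0"
      using t_pos[OF x(2)] by simp
    then have "has_row_slope (Y (Suc k)) (x / (t k)^2)"
      using has_row_slope_splitting_image image[OF x(1,2)] by simp
    moreover have "(x / (t k)^2)^2 = x^2 / ((t k)^2)^2"
      by (simp add: power_divide)
    ultimately show ?case
      using invariant_step[OF x(2-4) p_Suc[OF x(1,2)]] by metis
  qed
  then obtain x where x: "has_row_slope (Y k) (x k)" "0 \<le> p k" "(x k)^2 \<le> qmax"
    "(x k)^2 \<le> s * p k" for k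
    by metis

  have "p (Suc k) \<le> \<delta>^2 * p k" for k
    using invariant_step(2)[OF x(2-4) p_Suc[OF x(1,2)]] .
  then have "p k \<le> (\<delta>^2)^k * p 0" for k
  proof (induction k)
    case (Suc k)
    have "\<delta>^2 * p k \<le> \<delta>^2 * ((\<delta>^2)^k * p 0)"
      using Suc by (intro mult_left_mono) auto
    with Suc.prems[of k] show ?case
      by (simp add: mult.assoc)
  qed simp
  moreover have "(\<lambda>k. (\<delta>^2)^k * p 0) \<longlonglongrightarrow> 0"
    using \<open>\<delta>^2 < 1\<close> by (intro tendsto_mult_left_zero LIMSEQ_realpow_zero) auto
  ultimately have p_lim: "p \<longlonglongrightarrow> 0"
    using x(2) tendsto_sandwich[of "\<lambda>_. 0" p sequentially "\<lambda>k. (\<delta>^2)^k * p 0" 0]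
    by (simp only: eventually_sequentially tendsto_const) blast
  have "(\<lambda>k. (x k)^2) \<longlonglongrightarrow> 0"
  proof (rule real_tendsto_sandwich[OF _ _ tendsto_const])
    show "(\<lambda>k. s * p k) \<longlonglongrightarrow> 0"
      using tendsto_mult_right_zero[OF p_lim] .
  qed (use x(4) in auto)
  then have x_lim: "x \<longlonglongrightarrow> 0"
    using tendsto_real_sqrt by (fastforce simp: tendsto_rabs_zero_iff)
  have "t = (\<lambda>k. \<delta> * sqrt (b * (1 + p k)))"
    by (rule ext) (metis norm_sq norm_ge_zero real_sqrt_unique t_def)
  moreover have "(\<lambda>k. \<delta> * sqrt (b * (1 + p k))) \<longlonglongrightarrow> \<delta> * sqrt (b * (1 + 0))"
    by (intro tendsto_intros p_lim)
  moreover have "sqrt b = d_star \<delta>"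
    using \<open>d_star \<delta> > 0\<close> by (simp add: b_def)
  ultimately have t_lim: "t \<longlonglongrightarrow> \<delta> * d_star \<delta>" (is "_ \<longlonglongrightarrow> ?\<tau>")
    by simp
  have "?\<tau> > 0"
    using assms(1) \<open>d_star \<delta> > 0\<close> by simp
  have "\<forall>i j. (\<lambda>k. splitting_image (t k) (x k) $ i $ j) \<longlonglongrightarrow> splitting_image ?\<tau> 0 $ i $ j"
    unfolding forall_2 splitting_image_def vector_scaleR_component vector_2
    using assms(1) \<open>d_star \<delta> > 0\<close> by (intro conjI tendsto_intros x_lim t_lim) simp_all
  then have "(\<lambda>k. splitting_image (t k) (x k)) \<longlonglongrightarrow> splitting_image ?\<tau> 0"
    by (intro vec_tendstoI) blast
  moreover have "splitting_image ?\<tau> 0 = Y_star \<delta>"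
    using \<open>?\<tau> > 0\<close>
    by (simp add: splitting_image_def Y_star_def X_perp_def vec_eq_iff forall_2
        power2_eq_square power3_eq_cube)
  ultimately have "(\<lambda>k. splitting_image (t k) (x k)) \<longlonglongrightarrow> Y_star \<delta>"
    by simp
  then have "(\<lambda>k. Y (Suc k)) \<longlonglongrightarrow> Y_star \<delta>"
    using image[OF x(1,2)] by simp
  then show ?thesis
    by (rule LIMSEQ_imp_Suc)
qed

end
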